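(* Let $n\ge 1$, $R_n=\mathbb F_2[x_1,\dots,x_n]$, let $I_n=(e_{n,1},\dots,e_{n,n})+(x_1^2,\dots,x_n^2)\subseteq R_n$ and $A_n=R_n/I_n$, with its standard grading $A_n=\bigoplus_{j\ge 0}A_{n,j}$. The dimension $a_{n,j}=\dim_{\mathbb F_2}A_{n,j}$ is $$a_{n,j}=\begin{cases}\binom nj-\binom n{j-1} & \text{if } 0\le j\le\lfloor\frac n2\rfloor,\\ 0 & \text{if } j\ge\lfloor\frac n2\rfloor+1,\end{cases}$$ where $\binom n{-1}=0$. Since $\binom nj-\binom n{j-1}\ne0$ for all $0\le j\le\lfloor\frac n2\rfloor$, this implies that $$d_{\operatorname{reg}}(I_n)=\left\lfloor\frac n2\right\rfloor+1 .$$
   Context: $e_{n,j}=\sum_{\alpha\subseteq\{1,\dots,n\},\,|\alpha|=j}\prod_{a\in\alpha}x_a$ is the elementary symmetric polynomial of degree $j$ in $x_1,\dots,x_n$. $R_{n,j}$ is the $\mathbb F_2$-vector space of homogeneous polynomials of degree $j$ in $R_n$, and $A_{n,j}=R_{n,j}/(I_n\cap R_{n,j})$. For a homogeneous ideal $I\subseteq R_n$, the degree of regularity is $d_{\operatorname{reg}}(I)=\min\{d\in\mathbb N\mid I\cap R_{n,d}=R_{n,d}\}$. *)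

theory Defs
  imports
    "HOL-Library.Poly_Mapping"
    "HOL-Library.Z2"
    "HOL-Algebra.QuotRing"
    "Jordan_Normal_Form.VS_Connect"
begin

text \<open>
  A polynomial is a finitely supported map from monomials to coefficients in the
  field \<^typ>\<open>bit\<close> with two elements, and a monomial is a finitely supported map
  from variable indices to exponents. The type has variables \<open>x\<^sub>i\<close> for all natural
  numbers \<open>i\<close>; \<open>poly_carrier n\<close> consists of the polynomials in \<open>x\<^sub>1, \<dots>, x\<^sub>n\<close>.
\<close>

type_synonym mono = "nat \<Rightarrow>\<^sub>0 nat"
type_synonym bpoly = "mono \<Rightarrow>\<^sub>0 bit"

definition var :: "nat \<Rightarrow> bpoly" where
  "var i = Poly_Mapping.single (Poly_Mapping.single i 1) 1"

definition mono_degree :: "mono \<Rightarrow> nat" where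
  "mono_degree m = (\<Sum>i\<in>Poly_Mapping.keys m. Poly_Mapping.lookup m i)"

definition poly_carrier :: "nat \<Rightarrow> bpoly set" where
  "poly_carrier n = {p. \<forall>m\<in>Poly_Mapping.keys p. Poly_Mapping.keys m \<subseteq> {1..n}}"

definition poly_ring :: "nat \<Rightarrow> bpoly ring" where
  "poly_ring n = \<lparr>carrier = poly_carrier n, mult = (*), one = 1, zero = 0, add = (+)\<rparr>"

text \<open>The zero polynomial is homogeneous of every degree.\<close>

definition homog_carrier :: "nat \<Rightarrow> nat \<Rightarrow> bpoly set" where
  "homog_carrier n j =
     {p \<in> poly_carrier n. \<forall>m\<in>Poly_Mapping.keys p. mono_degree m = j}"

text \<open>
  The record type of modules extends that of rings, but the locales \<^locale>\<open>module\<close> and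
  \<^locale>\<open>vectorspace\<close> do not refer to the fields \<^const>\<open>mult\<close> and \<^const>\<open>one\<close> of the
  module. They are left undefined in the two definitions below.
\<close>

definition homog_part :: "nat \<Rightarrow> nat \<Rightarrow> (bit, bpoly) module" where
  "homog_part n j =
     \<lparr>carrier = homog_carrier n j, mult = undefined, one = undefined, zero = 0, add = (+),
      smult = (\<lambda>c p. Poly_Mapping.single 0 c * p)\<rparr>"

text \<open>
  For a submodule \<open>W\<close> of \<open>V\<close> the cosets in the union below all coincide, so it is the coset
  of \<open>c\<close> times any representative; this follows the pattern of \<^const>\<open>rcoset_mult\<close>.
\<close>

definition quot_module ::
  "('k, 'v, 'm) module_scheme \<Rightarrow> 'v set \<Rightarrow> ('k, 'v set) module" where
  "quot_module V W =
     \<lparr>carrier = a_rcosets\<^bsub>V\<^esub> W, mult = undefined, one = undefined, zero = W, add = set_add V,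
      smult = (\<lambda>c C. \<Union>v\<in>C. W +>\<^bsub>V\<^esub> (c \<odot>\<^bsub>V\<^esub> v))\<rparr>"

definition elem_sym :: "nat \<Rightarrow> nat \<Rightarrow> bpoly" where
  "elem_sym n j = (\<Sum>\<alpha> | \<alpha> \<subseteq> {1..n} \<and> card \<alpha> = j. \<Prod>a\<in>\<alpha>. var a)"

definition sym_ideal :: "nat \<Rightarrow> bpoly set" where
  "sym_ideal n =
     genideal (poly_ring n) (elem_sym n ` {1..n})
       <+>\<^bsub>poly_ring n\<^esub> genideal (poly_ring n) ((\<lambda>i. var i ^ 2) ` {1..n})"

definition quot_part :: "nat \<Rightarrow> nat \<Rightarrow> (bit, bpoly set) module" where
  "quot_part n j = quot_module (homog_part n j) (sym_ideal n \<inter> homog_carrier n j)"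

definition quot_dim :: "nat \<Rightarrow> nat \<Rightarrow> nat" where
  "quot_dim n j = vectorspace.dim (class_ring :: bit ring) (quot_part n j)"

text \<open>Meant for homogeneous ideals \<open>I\<close> of \<^term>\<open>poly_ring n\<close>.\<close>

definition deg_reg :: "nat \<Rightarrow> bpoly set \<Rightarrow> nat" where
  "deg_reg n I = (LEAST d. I \<inter> homog_carrier n d = homog_carrier n d)"

text \<open>The case distinction implements the convention that \<open>n\<close> choose \<open>-1\<close> is zero.\<close>

definition binom_diff :: "nat \<Rightarrow> nat \<Rightarrow> int" where
  "binom_diff n j = int (n choose j) - (if j = 0 then 0 else int (n choose (j - 1)))"

end

theory Submission
  imports Defs
begin

text \<open>
  Modulo the squares, \<open>e\<^sub>i\<close> times the squarefree monomial \<open>x\<^sub>T\<close> is the sum of all \<open>x\<^sub>S\<close> with \<open>T \<subseteq> S\<close>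
  and \<open>|S| = |T| + i\<close>. So in degree \<open>j\<close> the quotient is the space of formal sums of \<open>j\<close>-subsets
  modulo the sums of all supersets of sets \<open>T\<close> with \<open>|T| < j\<close>; it is dual to the Specht module of
  the shape \<open>(n - j, j)\<close>. The classes of \<open>x\<^sub>B\<close> form a basis, where \<open>B\<close> runs through the second rows of
  standard tableaux of that shape, i.e. the ballot sets. If \<open>2 j > n\<close>, inclusion-exclusion on the
  complement of \<open>S\<close> shows that every \<open>x\<^sub>S\<close> vanishes; from this, induction on \<open>n\<close> shows that the ballot
  sets span. They are independent because the polytabloids define functionals that kill the ideal and
  are triangular with respect to the sum of the elements of a set.
\<close>

section \<open>Ballot sets\<close>

text \<open>The recursion decides whether the largest element belongs to the set. Testing
  \<open>2 * Suc j \<le> Suc n\<close> at every level makes each initial segment contain at most as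
  many second-row as first-row entries.\<close>

fun ballots :: "nat \<Rightarrow> nat \<Rightarrow> nat set set" where
  "ballots n 0 = {{}}"
| "ballots 0 (Suc j) = {}"
| "ballots (Suc n) (Suc j) =
     (if 2 * Suc j \<le> Suc n then ballots n (Suc j) \<union> insert (Suc n) ` ballots n j else {})"

lemma ballots_eq_empty: "n < 2 * j \<Longrightarrow> ballots n j = {}"
  by (induction n j rule: ballots.induct) auto

lemma ballots_subset: "B \<in> ballots n j \<Longrightarrow> B \<subseteq> {1..n} \<and> card B = j"
proof (induction n j arbitrary: B rule: ballots.induct)
  case (3 n j)
  from 3(3) have le: "2 * Suc j \<le> Suc n"
    by (auto split: if_splits)
  from 3(3) le consider "B \<in> ballots n (Suc j)" | B' where "B = insert (Suc n) B'" "B' \<in> ballots n j"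
    by auto
  then show ?case
  proof cases
    case 1
    then have "B \<subseteq> {1..n}" "card B = Suc j" using 3(1)[OF le 1] by blast+
    then show ?thesis by auto
  next
    case 2
    then have "B' \<subseteq> {1..n}" "card B' = j" using 3(2)[OF le 2(2)] by blast+
    moreover from this have "finite B'" "Suc n \<notin> B'"
      by (auto simp: finite_subset[OF _ finite_atLeastAtMost])
    ultimately show ?thesis using 2 by auto
  qed
qed auto

lemma finite_ballot: "B \<in> ballots n j \<Longrightarrow> finite B"
  by (rule finite_subset[OF conjunct1[OF ballots_subset] finite_atLeastAtMost])

lemma finite_ballots: "finite (ballots n j)"
proof (rule finite_subset)
  show "ballots n j \<subseteq> Pow {1..n}" by (auto dest!: ballots_subset)
qed simp

text \<open>Both sides satisfy Pascal's recursion. The hypothesis admits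
  \<open>2 * j = Suc n\<close>, which the induction reaches through
  \<open>ballots n (Suc j)\<close>; there no ballot set exists and the two central binomial
  coefficients agree.\<close>

lemma card_ballots:
  "2 * j \<le> Suc n \<Longrightarrow> int (card (ballots n j)) = binom_diff n j"
proof (induction n j rule: ballots.induct)
  case (3 n j)
  have *: "2 * Suc j \<le> Suc (Suc n)" using 3(3) .
  show ?case
  proof (cases "2 * Suc j \<le> Suc n")
    case True
    have notin: "Suc n \<notin> B" if "B \<in> ballots n k" for B k
      using ballots_subset[OF that] by auto
    have inj: "inj_on (insert (Suc n)) (ballots n j)"
      using notin by (intro inj_onI) (metis insert_ident)
    have "ballots n (Suc j) \<inter> insert (Suc n) ` ballots n j = {}"
      using notin by blast
    then have "card (ballots (Suc n) (Suc j)) = card (ballots n (Suc j)) + card (ballots n j)"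
      using True by (simp add: card_Un_disjoint finite_ballots card_image[OF inj])
    moreover have "int (card (ballots n (Suc j))) = binom_diff n (Suc j)"
      using 3(1)[OF True] True by simp
    moreover have "int (card (ballots n j)) = binom_diff n j"
      using 3(2)[OF True] True by simp
    moreover have "binom_diff (Suc n) (Suc j) = binom_diff n (Suc j) + binom_diff n j"
      by (cases j) (simp_all add: binom_diff_def)
    ultimately show ?thesis by (simp only: of_nat_add)
  next
    case False
    with * have n: "n = 2 * j" by auto
    have "Suc (2 * j) choose Suc j = Suc (2 * j) choose j"
      using binomial_symmetric[of "Suc j" "Suc (2*j)"] by simp
    with False n show ?thesis by (simp add: binom_diff_def)
  qed
qed (auto simp: binom_diff_def)

text \<open>Binomial coefficients increase strictly up to the middle of the row.\<close>

lemma binom_diff_pos: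
  assumes "2 * j \<le> n"
  shows "binom_diff n j > 0"
proof (cases j)
  case (Suc k)
  have "n choose k < n choose Suc k"
    using assms Suc by (intro binomial_strict_mono) simp_all
  then show ?thesis by (simp add: binom_diff_def Suc)
qed (simp add: binom_diff_def)

text \<open>A ballot set is the set of second-row entries of a standard two-row tableau; the map \<open>m\<close>
  pairs each of them with a smaller entry of the first row.\<close>

lemma ballot_matching:
  "B \<in> ballots n j \<Longrightarrow> \<exists>m. inj_on m B \<and> m ` B \<subseteq> {1..n} - B \<and> (\<forall>b\<in>B. m b < b)"
proof (induction n j arbitrary: B rule: ballots.induct)
  case (3 n j)
  from 3(3) have le: "2 * Suc j \<le> Suc n"
    by (auto split: if_splits)
  from 3(3) le consider "B \<in> ballots n (Suc j)" | B' where "B = insert (Suc n) B'" "B' \<in> ballots n j"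
    by auto
  then show ?case
  proof cases
    case 1
    from 3(1)[OF le 1] obtain m where "inj_on m B" "m ` B \<subseteq> {1..n} - B" "\<forall>b\<in>B. m b < b"
      by blast
    moreover have "{1..n} - B \<subseteq> {1..Suc n} - B" by auto
    ultimately show ?thesis by blast
  next
    case 2
    from 3(2)[OF le 2(2)] obtain m where m: "inj_on m B'" "m ` B' \<subseteq> {1..n} - B'" "\<forall>b\<in>B'. m b < b"
      by auto
    have B': "B' \<subseteq> {1..n}" "card B' = j" "finite B'"
      using ballots_subset[OF 2(2)] finite_ballot[OF 2(2)] by auto
    \<comment> \<open>The set \<open>B'\<close> and its partners fill at most
      \<open>2 * j < n\<close> places, so some \<open>a\<close> in \<open>{1..n}\<close> is still
      free and becomes the partner of \<open>Suc n\<close>.\<close>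
    have "card (B' \<union> m ` B') \<le> j + j"
      using card_Un_le[of B' "m ` B'"] B' by (simp add: card_image m)
    then have "\<not> {1..n} \<subseteq> B' \<union> m ` B'"
      using le card_mono[of "B' \<union> m ` B'" "{1..n}"] B' by auto
    then obtain a where a: "a \<in> {1..n}" "a \<notin> B'" "a \<notin> m ` B'" by blast
    have S: "Suc n \<notin> B'" using B' by auto
    define m' where "m' = m(Suc n := a)"
    have im: "m' b = m b" if "b \<in> B'" for b
      using that S by (auto simp: m'_def)
    then have img: "m' ` B' = m ` B'" by (intro image_cong) simp_all
    have inj: "inj_on m' B'" using m(1) im by (simp cong: inj_on_cong)
    have last: "m' (Suc n) = a" by (simp add: m'_def)
    have "inj_on m' B"
      using S a(3) inj unfolding 2(1) by (simp add: last img)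
    moreover have "m' ` B \<subseteq> {1..Suc n} - B"
      using a(1,2) m(2) unfolding 2(1) by (auto simp: last img)
    moreover have "\<forall>b\<in>B. m' b < b"
      using a(1) m(3) im last unfolding 2(1) by simp
    ultimately show ?thesis by blast
  qed
qed auto

section \<open>Squarefree monomials and straightening\<close>

text \<open>Characteristic two: every polynomial is its own negative. Congruence of \<open>p\<close>
  and \<open>q\<close> modulo a subspace is therefore expressed below by membership of
  \<open>p + q\<close>.\<close>

lemma bpoly_add_self [simp]: "(p :: bpoly) + p = 0"
proof (rule poly_mapping_eqI)
  fix k
  have "a + a = 0" for a :: bit by (cases a) simp_all
  then show "Poly_Mapping.lookup (p + p) k = Poly_Mapping.lookup 0 k"
    by (simp only: lookup_add lookup_zero)
qed

lemma bpoly_two [simp]: "(2 :: bpoly) = 0"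
  by (simp only: one_add_one[symmetric] bpoly_add_self)

lemma even_of_nat_bpoly: "even k \<Longrightarrow> of_nat k * (p :: bpoly) = 0"
  by (elim evenE) simp

text \<open>Every nonzero coefficient is 1, so membership in an additively closed set containing 0
  can be checked on the monomials that occur.\<close>

lemma bpoly_eq_sum_keys: "(p :: bpoly) = (\<Sum>k\<in>Poly_Mapping.keys p. Poly_Mapping.single k 1)"
proof (rule poly_mapping_eqI)
  fix l
  have "Poly_Mapping.lookup (\<Sum>k\<in>Poly_Mapping.keys p. Poly_Mapping.single k 1) l =
      (\<Sum>k\<in>Poly_Mapping.keys p. if l = k then 1 else (0::bit))"
    by (auto simp: lookup_sum lookup_single when_def intro!: sum.cong)
  also have "\<dots> = Poly_Mapping.lookup p l"
    by (cases "l \<in> Poly_Mapping.keys p") (auto simp: in_keys_iff)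
  finally show "Poly_Mapping.lookup p l = Poly_Mapping.lookup (\<Sum>k\<in>Poly_Mapping.keys p. Poly_Mapping.single k 1) l" ..
qed

text \<open>The indicator function of \<open>S\<close> as an exponent vector. For infinite
  \<open>S\<close> the sum here and the product in \<open>xprod\<close> degenerate to 0 and 1,
  whence the finiteness hypotheses below.\<close>

definition smono :: "nat set \<Rightarrow> mono" where
  "smono S = (\<Sum>i\<in>S. Poly_Mapping.single i 1)"

definition xprod :: "nat set \<Rightarrow> bpoly" where
  "xprod S = (\<Prod>i\<in>S. var i)"

lemma lookup_smono: "finite S \<Longrightarrow> Poly_Mapping.lookup (smono S) i = (if i \<in> S then 1 else 0)"
proof -
  assume "finite S"
  then have "Poly_Mapping.lookup (smono S) i = (\<Sum>k\<in>S. if i = k then 1 else 0)"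
    unfolding smono_def lookup_sum by (intro sum.cong) (auto simp: lookup_single when_def)
  then show ?thesis using \<open>finite S\<close> by simp
qed

lemma keys_smono [simp]: "finite S \<Longrightarrow> Poly_Mapping.keys (smono S) = S"
  by (auto simp: in_keys_iff lookup_smono split: if_splits)

lemma smono_eq_iff: "finite S \<Longrightarrow> finite T \<Longrightarrow> smono S = smono T \<longleftrightarrow> S = T"
  by (metis keys_smono)

lemma mono_degree_smono: "finite S \<Longrightarrow> mono_degree (smono S) = card S"
  by (simp add: mono_degree_def lookup_smono)

lemma xprod_eq_single: "finite S \<Longrightarrow> xprod S = Poly_Mapping.single (smono S) 1"
  by (induction rule: finite_induct) (simp_all add: xprod_def smono_def var_def mult_single)

lemma lookup_xprod: "finite S \<Longrightarrow> Poly_Mapping.lookup (xprod S) k = (if k = smono S then 1 else 0)"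
  by (auto simp: xprod_eq_single lookup_single when_def)

lemma xprod_insert: "finite S \<Longrightarrow> i \<notin> S \<Longrightarrow> xprod (insert i S) = var i * xprod S"
  by (simp add: xprod_def)

lemma xprod_Un_disjoint: "finite S \<Longrightarrow> finite T \<Longrightarrow> S \<inter> T = {} \<Longrightarrow> xprod (S \<union> T) = xprod S * xprod T"
  by (simp add: xprod_def prod.union_disjoint)

lemma smono_keysI:
  assumes "\<And>i. Poly_Mapping.lookup k i \<le> 1"
  shows "k = smono (Poly_Mapping.keys k)"
proof (rule poly_mapping_eqI)
  fix i
  show "Poly_Mapping.lookup k i = Poly_Mapping.lookup (smono (Poly_Mapping.keys k)) i"
    using assms[of i] by (auto simp: lookup_smono in_keys_iff)
qed

text \<open>For \<open>T \<subseteq> {1..n}\<close> with \<open>card T < j\<close> this is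
  \<open>elem_sym n (j - card T) * xprod T\<close> reduced modulo the squares of the variables,
  hence a relation of degree \<open>j\<close> in the quotient.\<close>

definition superset_sum :: "nat \<Rightarrow> nat \<Rightarrow> nat set \<Rightarrow> bpoly" where
  "superset_sum n j T = (\<Sum>S | T \<subseteq> S \<and> S \<subseteq> {1..n} \<and> card S = j. xprod S)"

text \<open>Inclusion-exclusion without signs: on the right \<open>xprod S'\<close> is counted once
  for each \<open>T \<subseteq> S' - S\<close>, that is \<open>2 ^ card (S' - S)\<close> times. This
  is odd only if \<open>S' \<subseteq> S\<close>, and then \<open>S' = S\<close> because the
  cardinalities agree.\<close>

lemma xprod_eq_sum_superset_sum:
  assumes "S \<subseteq> {1..n}" "card S = j"
  shows "xprod S = (\<Sum>T\<in>Pow ({1..n} - S). superset_sum n j T)"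
proof -
  let ?K = "{S'. S' \<subseteq> {1..n} \<and> card S' = j}"
  have fin: "finite ?K" by simp
  have "(\<Sum>T\<in>Pow ({1..n} - S). superset_sum n j T) =
      (\<Sum>T\<in>Pow ({1..n} - S). \<Sum>S'\<in>?K. if T \<subseteq> S' then xprod S' else 0)"
  proof (rule sum.cong[OF refl])
    fix T
    show "superset_sum n j T = (\<Sum>S'\<in>?K. if T \<subseteq> S' then xprod S' else 0)"
      unfolding superset_sum_def by (subst sum.inter_filter[OF fin, symmetric]) (intro sum.cong, auto)
  qed
  also have "\<dots> = (\<Sum>S'\<in>?K. \<Sum>T\<in>Pow ({1..n} - S). if T \<subseteq> S' then xprod S' else 0)"
    by (rule sum.swap)
  also have "\<dots> = (\<Sum>S'\<in>?K. if S' = S then xprod S else 0)"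
  proof (intro sum.cong refl)
    fix S' assume S': "S' \<in> ?K"
    have fin': "finite S'" "finite S" using S' assms by (auto intro: finite_subset[OF _ finite_atLeastAtMost])
    have "(\<Sum>T\<in>Pow ({1..n} - S). if T \<subseteq> S' then xprod S' else 0) = (\<Sum>T\<in>Pow (S' - S). xprod S')"
    proof -
      have "{T \<in> Pow ({1..n} - S). T \<subseteq> S'} = Pow (S' - S)" using S' by auto
      then show ?thesis by (subst sum.inter_filter[symmetric]) auto
    qed
    also have "\<dots> = of_nat (2 ^ card (S' - S)) * xprod S'"
      using fin' by (simp add: card_Pow)
    also have "\<dots> = (if S' = S then xprod S else 0)"
    proof (cases "S' = S")
      case False
      then have "\<not> S' \<subseteq> S"
        using S' assms fin' by (metis (mono_tags, lifting) card_subset_eq mem_Collect_eq)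
      then have "card (S' - S) \<noteq> 0" using fin' by auto
      then show ?thesis using False by (intro trans[OF even_of_nat_bpoly]) auto
    qed simp
    finally show "(\<Sum>T\<in>Pow ({1..n} - S). if T \<subseteq> S' then xprod S' else 0) = (if S' = S then xprod S else 0)" .
  qed
  also have "\<dots> = xprod S" using assms by (simp add: fin)
  finally show ?thesis ..
qed

text \<open>Deleting \<open>Suc n\<close> from the supersets is a bijection. The identity turns
  relations for \<open>Suc n\<close> into relations for \<open>n\<close> when a subgroup is pulled
  back along multiplication by the last variable.\<close>

lemma superset_sum_insert_Suc:
  assumes "T \<subseteq> {1..n}"
  shows "superset_sum (Suc n) (Suc j) (insert (Suc n) T) = var (Suc n) * superset_sum n j T"
proof -
  have "superset_sum (Suc n) (Suc j) (insert (Suc n) T) =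
      (\<Sum>S | T \<subseteq> S \<and> S \<subseteq> {1..n} \<and> card S = j. xprod (insert (Suc n) S))"
    unfolding superset_sum_def
  proof (rule sum.reindex_bij_witness[of _ "insert (Suc n)" "\<lambda>S. S - {Suc n}"], goal_cases)
    case (2 S)
    then show ?case using assms by (auto simp: finite_subset[OF _ finite_atLeastAtMost] card_Diff_singleton)
  next
    case (4 S)
    then have "finite S" "Suc n \<notin> S" by (auto simp: finite_subset[OF _ finite_atLeastAtMost])
    then show ?case using 4 by auto
  qed (use assms in \<open>auto simp: insert_absorb\<close>)
  also have "\<dots> = (\<Sum>S | T \<subseteq> S \<and> S \<subseteq> {1..n} \<and> card S = j. var (Suc n) * xprod S)"
    by (intro sum.cong refl xprod_insert) (auto simp: finite_subset[OF _ finite_atLeastAtMost])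
  finally show ?thesis by (simp add: superset_sum_def sum_distrib_left)
qed

text \<open>The supersets are split by whether they contain \<open>Suc n\<close>; straightening
  deals with those that do first.\<close>

lemma superset_sum_Suc:
  "superset_sum (Suc n) j T = superset_sum n j T + (\<Sum>S | T \<subseteq> S \<and> S \<subseteq> {1..Suc n} \<and> Suc n \<in> S \<and> card S = j. xprod S)"
proof -
  have "{S. T \<subseteq> S \<and> S \<subseteq> {1..Suc n} \<and> card S = j} =
    {S. T \<subseteq> S \<and> S \<subseteq> {1..n} \<and> card S = j} \<union> {S. T \<subseteq> S \<and> S \<subseteq> {1..Suc n} \<and> Suc n \<in> S \<and> card S = j}"
    by (auto simp: atLeastAtMostSuc_conv)
  then show ?thesis unfolding superset_sum_def
    by (simp only:) (rule sum.union_disjoint; auto)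
qed

lemma sum_in_closed:
  fixes G :: "'a::comm_monoid_add set"
  assumes "0 \<in> G" "\<And>p q. p \<in> G \<Longrightarrow> q \<in> G \<Longrightarrow> p + q \<in> G" "\<And>x. x \<in> A \<Longrightarrow> f x \<in> G"
  shows "sum f A \<in> G"
  using assms(3) by (induction A rule: infinite_finite_induct) (auto intro: assms)

text \<open>Straightening: \<open>G\<close> stands for an arbitrary additive subgroup, so that the induction hypothesis
  can be applied to the preimage of \<open>G\<close> under multiplication by the last variable.\<close>

lemma ballots_span:
  fixes G :: "bpoly set"
  assumes "0 \<in> G" "\<And>p q. p \<in> G \<Longrightarrow> q \<in> G \<Longrightarrow> p + q \<in> G"
    and "\<And>B. B \<in> ballots n j \<Longrightarrow> xprod B \<in> G"
    and "\<And>T. T \<subseteq> {1..n} \<Longrightarrow> card T < j \<Longrightarrow> superset_sum n j T \<in> G"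
    and "S \<subseteq> {1..n}" "card S = j"
  shows "xprod S \<in> G"
  using assms
proof (induction n j arbitrary: G S rule: ballots.induct)
  case (1 n)
  have "S = {}" using 1(5,6) finite_subset[OF 1(5) finite_atLeastAtMost] by simp
  then show ?case using 1(3)[of "{}"] by simp
next
  case (2 j)
  from 2(5,6) show ?case by simp
next
  case (3 n j)
  note G = "3.prems"(1,2) and B = "3.prems"(3) and W = "3.prems"(4)
  show ?case
  proof (cases "2 * Suc j \<le> Suc n")
    case False
    \<comment> \<open>Beyond the middle degree the complement of \<open>S\<close> has fewer than
      \<open>Suc j\<close> elements, so every summand of the inclusion-exclusion formula is one of
      the given relations.\<close>
    have "superset_sum (Suc n) (Suc j) T \<in> G" if "T \<in> Pow ({1..Suc n} - S)" for T
    proof (rule W)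
      have "card T \<le> card ({1..Suc n} - S)"
        using that by (intro card_mono) auto
      also have "\<dots> = Suc n - Suc j"
        using "3.prems"(5,6) by (simp add: card_Diff_subset finite_subset[OF _ finite_atLeastAtMost])
      finally show "card T < Suc j" using False by auto
    qed (use that in auto)
    then show ?thesis
      by (subst xprod_eq_sum_superset_sum[OF "3.prems"(5,6)]) (rule sum_in_closed[OF G])
  next
    case True
    have step: "xprod S \<in> G" if S: "S \<subseteq> {1..Suc n}" "card S = Suc j" "Suc n \<in> S" for S
    proof -
      define S' where "S' = S - {Suc n}"
      have S': "S = insert (Suc n) S'" "S' \<subseteq> {1..n}" "Suc n \<notin> S'" "finite S'"
        using S by (auto simp: S'_def finite_subset[OF _ finite_atLeastAtMost])
      \<comment> \<open>The preimage of \<open>G\<close> under multiplication by the last variable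
        satisfies the hypotheses for \<open>n\<close> and \<open>j\<close>: adjoining
        \<open>Suc n\<close> takes ballot sets to ballot sets and relations to relations.\<close>
      have "xprod S' \<in> {p. var (Suc n) * p \<in> G}"
      proof (rule "3.IH"(2)[OF True])
        fix B assume B': "B \<in> ballots n j"
        then have "xprod (insert (Suc n) B) \<in> G" using True by (intro B) auto
        then show "xprod B \<in> {p. var (Suc n) * p \<in> G}"
          using ballots_subset[OF B'] finite_ballot[OF B'] by (subst (asm) xprod_insert) auto
      next
        fix T assume T: "T \<subseteq> {1..n}" "card T < j"
        then have "finite T" "Suc n \<notin> T" by (auto simp: finite_subset[OF _ finite_atLeastAtMost])
        then have "superset_sum (Suc n) (Suc j) (insert (Suc n) T) \<in> G"
          using T by (intro W) auto
        then show "superset_sum n j T \<in> {p. var (Suc n) * p \<in> G}"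
          using T by (simp add: superset_sum_insert_Suc)
      next
        show "card S' = j" using S S' by simp
      next
        show "0 \<in> {p. var (Suc n) * p \<in> G}" using G(1) by simp
      next
        fix p q
        assume "p \<in> {p. var (Suc n) * p \<in> G}" "q \<in> {p. var (Suc n) * p \<in> G}"
        then show "p + q \<in> {p. var (Suc n) * p \<in> G}"
          using G(2)[of "var (Suc n) * p" "var (Suc n) * q"] by (simp add: distrib_left)
      qed (rule S'(2))
      then show ?thesis using S' by (simp add: xprod_insert)
    qed
    show ?thesis
    proof (cases "Suc n \<in> S")
      case True
      with "3.prems"(5,6) show ?thesis by (rule step)
    next
      case False
      show ?thesis
      proof (rule "3.IH"(1)[OF True G])
        fix T assume T: "T \<subseteq> {1..n}" "card T < Suc j"
        \<comment> \<open>The relation for \<open>n\<close> is the one for \<open>Suc n\<close> plus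
          \<open>?R\<close>, since adding \<open>?R\<close> a second time cancels it. All terms of
          \<open>?R\<close> contain the last variable and lie in \<open>G\<close> by
          \<open>step\<close>.\<close>
        let ?R = "\<Sum>S | T \<subseteq> S \<and> S \<subseteq> {1..Suc n} \<and> Suc n \<in> S \<and> card S = Suc j. xprod S"
        have "superset_sum (Suc n) (Suc j) T \<in> G" using T by (intro W) auto
        moreover have "?R \<in> G" using step by (intro sum_in_closed[OF G]) auto
        ultimately have "superset_sum (Suc n) (Suc j) T + ?R \<in> G" by (rule G)
        then show "superset_sum n (Suc j) T \<in> G"
          by (simp add: superset_sum_Suc add.assoc)
      next
        fix B' assume "B' \<in> ballots n (Suc j)"
        then show "xprod B' \<in> G" using True by (intro B) simp
      next
        show "S \<subseteq> {1..n}" using "3.prems"(5) False by (simp add: atLeastAtMostSuc_conv subset_insert)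
      qed (assumption | rule "3.prems"(6))+
    qed
  qed
qed

section \<open>Quotients of vector spaces\<close>

text \<open>Once the operations on cosets are computed on representatives, each axiom is inherited
  from \<open>V\<close>. The scalar action and the subgroup property are stated as well, for
  calculations in the quotient.\<close>

lemma quot_module_vectorspace:
  fixes V (structure)
  assumes "vectorspace K V" and W: "Module.submodule W K V"
  shows "vectorspace K (quot_module V W)"
    and "v \<in> carrier V \<Longrightarrow> c \<in> carrier K \<Longrightarrow> c \<odot>\<^bsub>quot_module V W\<^esub> (W +> v) = W +> (c \<odot> v)"
    and "abelian_subgroup W V"
proof -
  interpret vectorspace K V by fact
  have sub: "subgroup W (add_monoid V)"
    using W by (simp add: Module.submodule_def)
  interpret W: abelian_subgroup W V
    by (intro abelian_subgroupI3 additive_subgroup.intro sub) unfold_locales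
  show "abelian_subgroup W V" by unfold_locales
  let ?Q = "quot_module V W"
  have carr: "carrier ?Q = (\<lambda>v. W +> v) ` carrier V"
    unfolding quot_module_def A_RCOSETS_def' by auto
  have add: "(W +> v) \<oplus>\<^bsub>?Q\<^esub> (W +> w) = W +> (v \<oplus> w)"
    if "v \<in> carrier V" "w \<in> carrier V" for v w
    using that by (simp add: quot_module_def W.a_rcos_sum)
  have zero: "\<zero>\<^bsub>?Q\<^esub> = W +> \<zero>"
    by (simp add: quot_module_def W.a_subset M.a_coset_add_zero)
  have smult: "c \<odot>\<^bsub>?Q\<^esub> (W +> v) = W +> (c \<odot> v)" if "v \<in> carrier V" "c \<in> carrier K" for c v
  proof -
    \<comment> \<open>Changing the representative by an element of \<open>W\<close> changes its
      multiple by an element of \<open>W\<close>, so the union defining the scalar action has equal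
      members; it is over a nonempty set because \<open>v\<close> lies in its own coset.\<close>
    have "W +> (c \<odot> u) = W +> (c \<odot> v)" if u: "u \<in> W +> v" for u
    proof -
      from u obtain w where w: "w \<in> W" "u = w \<oplus> v"
        by (auto simp: a_r_coset_def')
      have "w \<in> carrier V" using w W.a_subset by auto
      then have "c \<odot> u = c \<odot> w \<oplus> c \<odot> v"
        using w \<open>v \<in> carrier V\<close> \<open>c \<in> carrier K\<close> by (simp add: smult_r_distr)
      moreover have "c \<odot> w \<in> W"
        using W w \<open>c \<in> carrier K\<close> by (simp add: Module.submodule.smult_closed)
      ultimately have "c \<odot> u \<in> W +> (c \<odot> v)"
        by (auto simp: a_r_coset_def')
      then show ?thesis
        using M.a_repr_independence[OF _ _ sub] \<open>v \<in> carrier V\<close> \<open>c \<in> carrier K\<close> by simp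
    qed
    then have "(\<Union>u\<in>W +> v. W +> (c \<odot> u)) = (\<Union>u\<in>W +> v. W +> (c \<odot> v))"
      by (intro SUP_cong refl)
    moreover have "W +> v \<noteq> {}" using W.a_rcos_self that by blast
    ultimately show ?thesis by (simp add: quot_module_def)
  qed
  then show "v \<in> carrier V \<Longrightarrow> c \<in> carrier K \<Longrightarrow> c \<odot>\<^bsub>?Q\<^esub> (W +> v) = W +> (c \<odot> v)" .
  have repr: "\<exists>v\<in>carrier V. x = W +> v" if "x \<in> carrier ?Q" for x
    using that unfolding carr by blast
  have mem: "W +> v \<in> carrier ?Q" if "v \<in> carrier V" for v
    using that unfolding carr by blast
  have "abelian_group ?Q"
  proof (rule abelian_groupI)
    fix x y z assume "x \<in> carrier ?Q" "y \<in> carrier ?Q" "z \<in> carrier ?Q"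
    from this[THEN repr] obtain u v w where uvw: "u \<in> carrier V" "v \<in> carrier V" "w \<in> carrier V"
      and xyz: "x = W +> u" "y = W +> v" "z = W +> w"
      by (elim bexE)
    show "x \<oplus>\<^bsub>?Q\<^esub> y \<oplus>\<^bsub>?Q\<^esub> z = x \<oplus>\<^bsub>?Q\<^esub> (y \<oplus>\<^bsub>?Q\<^esub> z)"
      using uvw unfolding xyz by (simp only: add M.a_closed M.a_assoc)
  next
    fix x y assume "x \<in> carrier ?Q" "y \<in> carrier ?Q"
    from this[THEN repr] obtain u v where uv: "u \<in> carrier V" "v \<in> carrier V"
      and xy: "x = W +> u" "y = W +> v"
      by (elim bexE)
    show "x \<oplus>\<^bsub>?Q\<^esub> y = y \<oplus>\<^bsub>?Q\<^esub> x"
      using uv M.a_comm[of u v] unfolding xy by (simp only: add)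
    show "x \<oplus>\<^bsub>?Q\<^esub> y \<in> carrier ?Q"
      using uv unfolding xy by (simp only: add mem M.a_closed)
  next
    fix x assume "x \<in> carrier ?Q"
    from repr[OF this] obtain u where u: "u \<in> carrier V" and x: "x = W +> u"
      by (elim bexE)
    show "\<zero>\<^bsub>?Q\<^esub> \<oplus>\<^bsub>?Q\<^esub> x = x"
      using u unfolding x zero by (simp only: add M.zero_closed M.l_zero)
    have "(W +> \<ominus> u) \<oplus>\<^bsub>?Q\<^esub> x = \<zero>\<^bsub>?Q\<^esub>"
      using u unfolding x zero by (simp only: add M.a_inv_closed M.l_neg)
    then show "\<exists>y\<in>carrier ?Q. y \<oplus>\<^bsub>?Q\<^esub> x = \<zero>\<^bsub>?Q\<^esub>"
      by (rule bexI) (intro mem M.a_inv_closed u)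
  next
    show "\<zero>\<^bsub>?Q\<^esub> \<in> carrier ?Q"
      unfolding zero by (intro mem M.zero_closed)
  qed
  then have "module K ?Q"
  proof (rule moduleI[OF R.is_cring])
    fix a b x y
    assume a: "a \<in> carrier K" and "x \<in> carrier ?Q"
    from repr[OF this(2)] obtain u where u: "u \<in> carrier V" and x: "x = W +> u"
      by (elim bexE)
    show "a \<odot>\<^bsub>?Q\<^esub> x \<in> carrier ?Q"
      using a u unfolding x by (simp only: smult mem smult_closed)
    show "(a \<oplus>\<^bsub>K\<^esub> b) \<odot>\<^bsub>?Q\<^esub> x = (a \<odot>\<^bsub>?Q\<^esub> x) \<oplus>\<^bsub>?Q\<^esub> (b \<odot>\<^bsub>?Q\<^esub> x)" if "b \<in> carrier K"
      using a that u unfolding x by (simp only: smult add smult_closed R.a_closed smult_l_distr)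
    show "(a \<otimes>\<^bsub>K\<^esub> b) \<odot>\<^bsub>?Q\<^esub> x = a \<odot>\<^bsub>?Q\<^esub> (b \<odot>\<^bsub>?Q\<^esub> x)" if "b \<in> carrier K"
      using a that u unfolding x by (simp only: smult smult_closed R.m_closed smult_assoc1)
    show "a \<odot>\<^bsub>?Q\<^esub> (x \<oplus>\<^bsub>?Q\<^esub> y) = (a \<odot>\<^bsub>?Q\<^esub> x) \<oplus>\<^bsub>?Q\<^esub> (a \<odot>\<^bsub>?Q\<^esub> y)" if "y \<in> carrier ?Q"
    proof -
      from repr[OF that] obtain v where v: "v \<in> carrier V" and y: "y = W +> v"
        by (elim bexE)
      show ?thesis
        using a u v unfolding x y by (simp only: smult add smult_closed M.a_closed smult_r_distr)
    qed
  next
    fix x assume "x \<in> carrier ?Q"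
    from repr[OF this] obtain u where u: "u \<in> carrier V" and x: "x = W +> u"
      by (elim bexE)
    show "\<one>\<^bsub>K\<^esub> \<odot>\<^bsub>?Q\<^esub> x = x"
      using u unfolding x
      by (simp only: smult R.one_closed smult_one)
  qed
  then show "vectorspace K ?Q"
    using assms(1) unfolding vectorspace_def by blast
qed

section \<open>Homogeneous parts and their quotients over the field with two elements\<close>

lemma homog_carrier_add:
  "p \<in> homog_carrier n j \<Longrightarrow> q \<in> homog_carrier n j \<Longrightarrow> p + q \<in> homog_carrier n j"
  using keys_add[of p q] unfolding homog_carrier_def poly_carrier_def by blast

lemma homog_carrier_0: "0 \<in> homog_carrier n j"
  by (simp add: homog_carrier_def poly_carrier_def)

lemma homog_part_vectorspace: "vectorspace class_ring (homog_part n j)"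
proof -
  have "module (class_ring :: bit ring) (homog_part n j)"
  proof (rule moduleI)
    show "cring (class_ring :: bit ring)" by unfold_locales
    show "abelian_group (homog_part n j)"
    proof (rule abelian_groupI)
      fix p assume "p \<in> carrier (homog_part n j)"
      then show "\<exists>q\<in>carrier (homog_part n j). q \<oplus>\<^bsub>homog_part n j\<^esub> p = \<zero>\<^bsub>homog_part n j\<^esub>"
        by (intro bexI[of _ p]) (simp_all only: homog_part_def module.simps partial_object.simps
          monoid.simps ring.simps bpoly_add_self)
    qed (simp_all add: homog_part_def homog_carrier_add homog_carrier_0 algebra_simps)
    show "c \<odot>\<^bsub>homog_part n j\<^esub> p \<in> carrier (homog_part n j)"
      if "p \<in> carrier (homog_part n j)" for c :: bit and p
      using that by (cases c) (simp_all add: homog_part_def homog_carrier_0)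
    show "(a \<oplus>\<^bsub>class_ring\<^esub> b) \<odot>\<^bsub>homog_part n j\<^esub> p =
       (a \<odot>\<^bsub>homog_part n j\<^esub> p) \<oplus>\<^bsub>homog_part n j\<^esub> (b \<odot>\<^bsub>homog_part n j\<^esub> p)" for a b :: bit and p
      by (cases a; cases b) (simp_all add: homog_part_def)
    show "(a \<otimes>\<^bsub>class_ring\<^esub> b) \<odot>\<^bsub>homog_part n j\<^esub> p =
       a \<odot>\<^bsub>homog_part n j\<^esub> (b \<odot>\<^bsub>homog_part n j\<^esub> p)" for a b :: bit and p
      by (simp add: homog_part_def mult_single flip: mult.assoc)
    show "\<one>\<^bsub>class_ring :: bit ring\<^esub> \<odot>\<^bsub>homog_part n j\<^esub> p = p" for p
      by (simp add: homog_part_def)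
  qed (simp add: homog_part_def distrib_left)
  then show ?thesis
    by (intro vectorspace.intro class_field.field_axioms)
qed

text \<open>The only scalars are 0 and 1 and each element is its own negative, so a subset that
  contains 0 and is closed under addition is a subspace.\<close>

lemma homog_part_submodule:
  assumes "0 \<in> W" "W \<subseteq> homog_carrier n j" "\<And>p q. p \<in> W \<Longrightarrow> q \<in> W \<Longrightarrow> p + q \<in> W"
  shows "Module.submodule W class_ring (homog_part n j)"
proof -
  interpret vectorspace class_ring "homog_part n j" by (rule homog_part_vectorspace)
  have inv: "\<ominus>\<^bsub>homog_part n j\<^esub> p = p" if "p \<in> W" for p
    using that assms(2) by (intro M.minus_equality) (auto simp: homog_part_def)
  show ?thesis
  proof (rule module.submoduleI)
    show "c \<odot>\<^bsub>homog_part n j\<^esub> p \<in> W" if "p \<in> W" for c :: bit and p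
      using that assms(1) by (cases c) (simp_all add: homog_part_def)
  qed (use assms inv in \<open>simp_all add: homog_part_def\<close>, unfold_locales)
qed

text \<open>Over the field with two elements a linear combination of a finite family is the sum over
  a subset of its indices. The hypotheses \<open>span\<close> and \<open>indep\<close> thus say that
  the classes of the \<open>x i\<close> form a basis of the quotient, in terms of representatives
  only.\<close>

lemma dim_quot_homog_part:
  fixes x :: "'i \<Rightarrow> bpoly"
  assumes W: "0 \<in> W" "W \<subseteq> homog_carrier n j" "\<And>p q. p \<in> W \<Longrightarrow> q \<in> W \<Longrightarrow> p + q \<in> W"
    and J: "finite J" and x: "\<And>i. i \<in> J \<Longrightarrow> x i \<in> homog_carrier n j"
    and span: "\<And>p. p \<in> homog_carrier n j \<Longrightarrow> \<exists>C\<subseteq>J. p + sum x C \<in> W"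
    and indep: "\<And>C. C \<subseteq> J \<Longrightarrow> sum x C \<in> W \<Longrightarrow> C = {}"
  shows "vectorspace.dim class_ring (quot_module (homog_part n j) W) = card J"
proof -
  define H where "H = homog_part n j"
  define Q where "Q = quot_module H W"
  define q where "q = (\<lambda>p. W +>\<^bsub>H\<^esub> p)"
  have sub: "Module.submodule W class_ring H" unfolding H_def using W by (rule homog_part_submodule)
  note * = homog_part_vectorspace[of n j, folded H_def]
  interpret H: vectorspace class_ring H by (rule *)
  interpret Q: vectorspace class_ring Q
    unfolding Q_def by (rule quot_module_vectorspace(1)[OF * sub])
  interpret W: abelian_subgroup W H by (rule quot_module_vectorspace(3)[OF * sub])
  have H: "carrier H = homog_carrier n j" "add H = (+)" "zero H = 0"
    by (simp_all add: H_def homog_part_def)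
  have carr: "carrier Q = q ` homog_carrier n j"
    by (auto simp: Q_def q_def quot_module_def A_RCOSETS_def' H)
  have add: "q p \<oplus>\<^bsub>Q\<^esub> q p' = q (p + p')" if "p \<in> homog_carrier n j" "p' \<in> homog_carrier n j" for p p'
    using that W.a_rcos_sum[of p p'] by (simp add: Q_def q_def quot_module_def H)
  have zero: "\<zero>\<^bsub>Q\<^esub> = q 0"
    using H.M.a_coset_add_zero[OF W.a_subset] by (simp add: Q_def q_def quot_module_def H)
  have smult: "c \<odot>\<^bsub>Q\<^esub> q p = q (if c = 1 then p else 0)" if "p \<in> homog_carrier n j" for c p
    using quot_module_vectorspace(2)[OF * sub, of p c] that
    by (cases c) (simp_all add: Q_def q_def H_def homog_part_def)
  have q_eq: "q p = q p' \<longleftrightarrow> p + p' \<in> W" if "p \<in> homog_carrier n j" "p' \<in> homog_carrier n j" for p p'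
  proof
    assume "q p = q p'"
    then have "p \<in> W +>\<^bsub>H\<^esub> p'" using W.a_rcos_self[of p] that by (simp add: q_def H)
    then obtain w where "w \<in> W" "p = w + p'" by (auto simp: a_r_coset_def' H)
    then show "p + p' \<in> W" by (simp only: add.assoc bpoly_add_self add_0_right)
  next
    assume "p + p' \<in> W"
    moreover have "p = (p + p') + p'" by (simp only: add.assoc bpoly_add_self add_0_right)
    ultimately have "\<exists>w\<in>W. p = w + p'" by blast
    then have "p \<in> W +>\<^bsub>H\<^esub> p'" by (simp add: a_r_coset_def' H)
    then show "q p = q p'"
      using H.M.a_repr_independence[OF _ _ W.a_subgroup] that by (simp add: q_def H)
  qed
  have sum_closed: "sum f C \<in> homog_carrier n j" if "\<And>i. i \<in> C \<Longrightarrow> f i \<in> homog_carrier n j"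
    for f :: "'i \<Rightarrow> bpoly" and C
    using that by (intro sum_in_closed homog_carrier_0 homog_carrier_add)
  have finsum: "(\<Oplus>\<^bsub>Q\<^esub>i\<in>C. q (f i)) = q (sum f C)"
    if "finite C" "\<And>i. i \<in> C \<Longrightarrow> f i \<in> homog_carrier n j" for f :: "'i \<Rightarrow> bpoly" and C
    using that
  proof (induction C rule: finite_induct)
    case (insert i C)
    have "(\<lambda>i. q (f i)) \<in> C \<rightarrow> carrier Q" "q (f i) \<in> carrier Q"
      using insert.prems by (auto simp: carr)
    then have "(\<Oplus>\<^bsub>Q\<^esub>i\<in>insert i C. q (f i)) = q (f i) \<oplus>\<^bsub>Q\<^esub> (\<Oplus>\<^bsub>Q\<^esub>i\<in>C. q (f i))"
      using insert.hyps by (intro Q.M.finsum_insert)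
    then show ?case
      using insert by (simp add: add sum_closed)
  qed (simp add: zero)
  have sum_symdiff: "sum x {i, k} \<in> W" if "i \<in> J" "k \<in> J" "i \<noteq> k" "q (x i) = q (x k)" for i k
    using that q_eq x by simp
  \<comment> \<open>Distinct indices with the same class would give a two-element set whose sum lies
    in \<open>W\<close>, against \<open>indep\<close>. Hence the basis has as many elements as
    \<open>J\<close>.\<close>
  have inj: "inj_on (\<lambda>i. q (x i)) J"
  proof (rule inj_onI, rule ccontr)
    fix i k assume "i \<in> J" "k \<in> J" "q (x i) = q (x k)" "i \<noteq> k"
    then show False using indep[of "{i, k}"] sum_symdiff[of i k] by auto
  qed
  define A where "A = (\<lambda>i. q (x i)) ` J"
  \<comment> \<open>The coefficients select the subset of indices where they equal 1.\<close>
  have lincomb: "Q.lincomb a ((\<lambda>i. q (x i)) ` C) = q (sum x {i \<in> C. a (q (x i)) = 1})"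
    if C: "C \<subseteq> J" for a C
  proof -
    have fin: "finite C" using C J finite_subset by auto
    have "Q.lincomb a ((\<lambda>i. q (x i)) ` C) = (\<Oplus>\<^bsub>Q\<^esub>i\<in>C. a (q (x i)) \<odot>\<^bsub>Q\<^esub> q (x i))"
      unfolding Q.lincomb_def
      using C x inj_on_subset[OF inj C] by (intro Q.M.finsum_reindex) (auto simp: carr smult homog_carrier_0)
    also have "\<dots> = (\<Oplus>\<^bsub>Q\<^esub>i\<in>C. q (if a (q (x i)) = 1 then x i else 0))"
      using C x by (intro Q.M.finsum_cong') (auto simp: smult carr homog_carrier_0)
    also have "\<dots> = q (\<Sum>i\<in>C. if a (q (x i)) = 1 then x i else 0)"
      using C x fin by (intro finsum) (auto simp: homog_carrier_0)
    finally show ?thesis by (simp add: sum.inter_filter[OF fin])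
  qed
  have "Q.basis A" unfolding Q.basis_def
  proof (intro conjI)
    show sub: "A \<subseteq> carrier Q" using x by (auto simp: A_def carr)
    show "Q.lin_indpt A"
    proof
      assume "Q.lin_dep A"
      then obtain A' a v where A': "A' \<subseteq> A" "Q.lincomb a A' = \<zero>\<^bsub>Q\<^esub>" "v \<in> A'" "a v \<noteq> (0::bit)"
        unfolding Q.lin_dep_def by auto
      then obtain C where C: "C \<subseteq> J" "A' = (\<lambda>i. q (x i)) ` C"
        unfolding A_def by (meson subset_imageE)
      let ?C = "{i \<in> C. a (q (x i)) = 1}"
      have "q (sum x ?C) = q 0"
        using A' C lincomb[OF C(1), of a] zero by simp
      moreover have "sum x ?C \<in> homog_carrier n j"
        using C x by (intro sum_closed) auto
      ultimately have "sum x ?C \<in> W"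
        by (simp add: q_eq homog_carrier_0)
      then have "?C = {}" using indep[of ?C] C by auto
      then show False using A' C by auto
    qed
    show "Q.span A = carrier Q"
    proof
      show "Q.span A \<subseteq> carrier Q" using Q.span_is_subset2[OF sub] .
      show "carrier Q \<subseteq> Q.span A"
      proof
        fix v assume "v \<in> carrier Q"
        then obtain p where p: "p \<in> homog_carrier n j" "v = q p" by (auto simp: carr)
        from span[OF p(1)] obtain C where C: "C \<subseteq> J" "p + sum x C \<in> W" by auto
        have "sum x C \<in> homog_carrier n j" using C x by (intro sum_closed) auto
        then have "v = q (sum x C)" using p C q_eq by simp
        also have "\<dots> = Q.lincomb (\<lambda>_. 1) ((\<lambda>i. q (x i)) ` C)"
          using lincomb[OF C(1), of "\<lambda>_. 1"] by simp
        finally show "v \<in> Q.span A"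
          unfolding Q.span_def A_def using C J
          by (auto intro!: exI[of _ "\<lambda>_. 1 :: bit"] exI[of _ "(\<lambda>i. q (x i)) ` C"] intro: finite_subset)
      qed
    qed
  qed
  then have "Q.dim = card A"
    using J by (intro Q.dim_basis) (simp_all add: A_def)
  then show ?thesis
    using card_image[OF inj] by (simp add: A_def Q_def H_def)
qed

section \<open>The ideal and its spanning monomials\<close>

lemma poly_carrier_0: "0 \<in> poly_carrier n" and poly_carrier_1: "1 \<in> poly_carrier n"
  by (simp_all add: poly_carrier_def flip: single_one)

lemma poly_carrier_add: "p \<in> poly_carrier n \<Longrightarrow> q \<in> poly_carrier n \<Longrightarrow> p + q \<in> poly_carrier n"
  using keys_add[of p q] unfolding poly_carrier_def by blast

lemma poly_carrier_mult:
  assumes "p \<in> poly_carrier n" "q \<in> poly_carrier n"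
  shows "p * q \<in> poly_carrier n"
  unfolding poly_carrier_def
proof (intro CollectI ballI)
  fix k assume "k \<in> Poly_Mapping.keys (p * q)"
  then obtain a b where "a \<in> Poly_Mapping.keys p" "b \<in> Poly_Mapping.keys q" "k = a + b"
    using keys_mult[of p q] by blast
  then show "Poly_Mapping.keys k \<subseteq> {1..n}"
    using assms keys_add[of a b] unfolding poly_carrier_def by blast
qed

lemma poly_ring_cring: "cring (poly_ring n)"
proof (rule cringI)
  show "abelian_group (poly_ring n)"
  proof (rule abelian_groupI)
    fix p assume "p \<in> carrier (poly_ring n)"
    then show "\<exists>q\<in>carrier (poly_ring n). q \<oplus>\<^bsub>poly_ring n\<^esub> p = \<zero>\<^bsub>poly_ring n\<^esub>"
      by (intro bexI[of _ p])
        (simp_all only: poly_ring_def partial_object.simps monoid.simps ring.simps bpoly_add_self)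
  qed (simp_all add: poly_ring_def poly_carrier_add poly_carrier_0 algebra_simps)
  show "Group.comm_monoid (poly_ring n)"
    by (rule comm_monoidI)
      (simp_all add: poly_ring_def poly_carrier_mult poly_carrier_1 algebra_simps)
qed (simp add: poly_ring_def distrib_right)

lemma var_carrier: "i \<in> {1..n} \<Longrightarrow> var i \<in> poly_carrier n"
  by (simp add: poly_carrier_def var_def)

lemma xprod_carrier: "S \<subseteq> {1..n} \<Longrightarrow> xprod S \<in> poly_carrier n"
  using finite_subset[of S "{1..n}"] by (simp add: poly_carrier_def xprod_eq_single)

lemma xprod_homog: "S \<subseteq> {1..n} \<Longrightarrow> xprod S \<in> homog_carrier n (card S)"
  using finite_subset[of S "{1..n}"] xprod_carrier[of S n]
  by (simp add: homog_carrier_def xprod_eq_single mono_degree_smono)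

lemma single_carrier: "Poly_Mapping.keys k \<subseteq> {1..n} \<Longrightarrow> Poly_Mapping.single k c \<in> poly_carrier n"
  by (simp add: poly_carrier_def)

lemma elem_sym_eq: "elem_sym n j = (\<Sum>\<alpha> | \<alpha> \<subseteq> {1..n} \<and> card \<alpha> = j. xprod \<alpha>)"
  by (simp add: elem_sym_def xprod_def)

lemma elem_sym_carrier: "elem_sym n j \<in> poly_carrier n"
  unfolding elem_sym_eq
  by (intro sum_in_closed poly_carrier_0 poly_carrier_add) (simp_all add: xprod_carrier)

text \<open>The sum of the two generated ideals is the least ideal containing both families of
  generators; later arguments use only these four facts about \<open>sym_ideal\<close>.\<close>

lemma sym_ideal_ideal: "ideal (sym_ideal n) (poly_ring n)"
  and elem_sym_in_sym_ideal: "j \<in> {1..n} \<Longrightarrow> elem_sym n j \<in> sym_ideal n"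
  and var_square_in_sym_ideal: "i \<in> {1..n} \<Longrightarrow> var i ^ 2 \<in> sym_ideal n"
  and sym_ideal_subset: "\<And>J. ideal J (poly_ring n) \<Longrightarrow> elem_sym n ` {1..n} \<subseteq> J \<Longrightarrow>
         (\<lambda>i. var i ^ 2) ` {1..n} \<subseteq> J \<Longrightarrow> sym_ideal n \<subseteq> J"
proof -
  interpret cring "poly_ring n" by (rule poly_ring_cring)
  let ?E = "elem_sym n ` {1..n}" and ?Q = "(\<lambda>i. var i ^ 2) ` {1..n}"
  have sub: "?E \<subseteq> carrier (poly_ring n)" "?Q \<subseteq> carrier (poly_ring n)"
    using elem_sym_carrier var_carrier poly_carrier_mult
    by (auto simp: poly_ring_def power2_eq_square)
  interpret E: ideal "Idl\<^bsub>poly_ring n\<^esub> ?E" "poly_ring n" by (rule genideal_ideal[OF sub(1)])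
  interpret Q: ideal "Idl\<^bsub>poly_ring n\<^esub> ?Q" "poly_ring n" by (rule genideal_ideal[OF sub(2)])
  show "ideal (sym_ideal n) (poly_ring n)"
    unfolding sym_ideal_def by (intro add_ideals) unfold_locales
  have sum: "sym_ideal n = {e + q |e q. e \<in> Idl\<^bsub>poly_ring n\<^esub> ?E \<and> q \<in> Idl\<^bsub>poly_ring n\<^esub> ?Q}"
    unfolding sym_ideal_def set_add_def' by (auto simp: poly_ring_def)
  have 0: "0 \<in> Idl\<^bsub>poly_ring n\<^esub> ?E" "0 \<in> Idl\<^bsub>poly_ring n\<^esub> ?Q"
    using additive_subgroup.zero_closed[OF E.additive_subgroup_axioms]
      additive_subgroup.zero_closed[OF Q.additive_subgroup_axioms] by (simp_all add: poly_ring_def)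
  show "elem_sym n j \<in> sym_ideal n" if "j \<in> {1..n}"
  proof -
    have "elem_sym n j \<in> Idl\<^bsub>poly_ring n\<^esub> ?E"
      using genideal_self[OF sub(1)] that by blast
    then show ?thesis
      unfolding sum using 0(2) by (intro CollectI exI[of _ "elem_sym n j"] exI[of _ 0]) simp
  qed
  show "var i ^ 2 \<in> sym_ideal n" if "i \<in> {1..n}"
  proof -
    have "var i ^ 2 \<in> Idl\<^bsub>poly_ring n\<^esub> ?Q"
      using genideal_self[OF sub(2)] that by blast
    then show ?thesis
      unfolding sum using 0(1) by (intro CollectI exI[of _ 0] exI[of _ "var i ^ 2"]) simp
  qed
  show "sym_ideal n \<subseteq> J" if "ideal J (poly_ring n)" "?E \<subseteq> J" "?Q \<subseteq> J" for J
  proof -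
    interpret J: ideal J "poly_ring n" by fact
    have "Idl\<^bsub>poly_ring n\<^esub> ?E \<subseteq> J" "Idl\<^bsub>poly_ring n\<^esub> ?Q \<subseteq> J"
      by (intro genideal_minimal that)+
    moreover have "e + q \<in> J" if "e \<in> J" "q \<in> J" for e q
      using additive_subgroup.a_closed[OF J.additive_subgroup_axioms that]
      by (simp add: poly_ring_def)
    ultimately show ?thesis
      unfolding sum by blast
  qed
qed

lemma sym_ideal_0: "0 \<in> sym_ideal n"
  and sym_ideal_add: "p \<in> sym_ideal n \<Longrightarrow> q \<in> sym_ideal n \<Longrightarrow> p + q \<in> sym_ideal n"
  and sym_ideal_mult: "p \<in> sym_ideal n \<Longrightarrow> q \<in> poly_carrier n \<Longrightarrow> p * q \<in> sym_ideal n"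
proof -
  interpret ideal "sym_ideal n" "poly_ring n" by (rule sym_ideal_ideal)
  show "0 \<in> sym_ideal n" using additive_subgroup.zero_closed[OF additive_subgroup_axioms] by (simp add: poly_ring_def)
  show "p \<in> sym_ideal n \<Longrightarrow> q \<in> sym_ideal n \<Longrightarrow> p + q \<in> sym_ideal n"
    using additive_subgroup.a_closed[OF additive_subgroup_axioms, of p q] by (simp add: poly_ring_def)
  show "p \<in> sym_ideal n \<Longrightarrow> q \<in> poly_carrier n \<Longrightarrow> p * q \<in> sym_ideal n"
    using I_r_closed[of p q] by (simp add: poly_ring_def)
qed

text \<open>Each polynomial is its own negative, so closure under addition already yields an
  additive subgroup.\<close>

lemma ideal_poly_ringI:
  assumes "J \<subseteq> poly_carrier n" "0 \<in> J" "\<And>p q. p \<in> J \<Longrightarrow> q \<in> J \<Longrightarrow> p + q \<in> J"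
    and mult: "\<And>p q. p \<in> J \<Longrightarrow> q \<in> poly_carrier n \<Longrightarrow> p * q \<in> J"
  shows "ideal J (poly_ring n)"
proof -
  interpret cring "poly_ring n" by (rule poly_ring_cring)
  have inv: "\<ominus>\<^bsub>poly_ring n\<^esub> p = p" if "p \<in> J" for p
    using that assms(1) by (intro minus_equality) (auto simp: poly_ring_def)
  have "subgroup J (add_monoid (poly_ring n))"
  proof (rule group.subgroupI[OF a_group])
    show "inv\<^bsub>add_monoid (poly_ring n)\<^esub> p \<in> J" if "p \<in> J" for p
      using inv[OF that] that by (simp add: a_inv_def)
    show "J \<noteq> {}" using assms(2) by blast
  qed (use assms(1,3) in \<open>simp_all add: poly_ring_def\<close>)
  then show ?thesis
    by (rule idealI[OF ring_axioms]) (use mult in \<open>auto simp: poly_ring_def mult.commute\<close>)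
qed

section \<open>Relations in the ideal and reduction to ballot monomials\<close>

lemma nonsqfree_in_sym_ideal:
  assumes k: "Poly_Mapping.keys k \<subseteq> {1..n}" and i: "Poly_Mapping.lookup k i \<ge> 2"
  shows "Poly_Mapping.single k 1 \<in> sym_ideal n"
proof -
  let ?k = "k - Poly_Mapping.single i 2"
  have "k = Poly_Mapping.single i 1 + Poly_Mapping.single i 1 + ?k"
    using i by (intro poly_mapping_eqI) (auto simp: lookup_add lookup_minus lookup_single when_def)
  then have "Poly_Mapping.single k 1 = var i ^ 2 * Poly_Mapping.single ?k (1 :: bit)"
    by (simp add: var_def power2_eq_square mult_single)
  moreover have "i \<in> {1..n}" using k i by (auto simp: subset_iff in_keys_iff)
  moreover have "Poly_Mapping.keys ?k \<subseteq> {1..n}"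
    using k by (auto simp: subset_iff in_keys_iff lookup_minus)
  ultimately show ?thesis
    by (simp add: sym_ideal_mult var_square_in_sym_ideal single_carrier)
qed

lemma xprod_mult_in_sym_ideal:
  assumes "S \<subseteq> {1..n}" "T \<subseteq> {1..n}" "S \<inter> T \<noteq> {}"
  shows "xprod S * xprod T \<in> sym_ideal n"
proof -
  have fin: "finite S" "finite T"
    using assms by (auto intro: finite_subset[OF _ finite_atLeastAtMost])
  obtain i where "i \<in> S" "i \<in> T" using assms(3) by auto
  then have "Poly_Mapping.lookup (smono S + smono T) i \<ge> 2"
    using fin by (simp add: lookup_add lookup_smono)
  moreover have "Poly_Mapping.keys (smono S + smono T) \<subseteq> {1..n}"
    using keys_add[of "smono S" "smono T"] fin assms by auto
  ultimately show ?thesis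
    using nonsqfree_in_sym_ideal fin by (simp add: xprod_eq_single mult_single)
qed

text \<open>Multiply \<open>elem_sym n (j - card T)\<close>, whose degree is positive, by
  \<open>xprod T\<close>. The terms with \<open>\<alpha>\<close> disjoint from \<open>T\<close> give
  the superset sum, and all other terms contain the square of a variable.\<close>

lemma superset_sum_in_sym_ideal:
  assumes T: "T \<subseteq> {1..n}" "card T < j"
  shows "superset_sum n j T \<in> sym_ideal n"
proof (cases "j \<le> n")
  case False
  \<comment> \<open>For \<open>j > n\<close> the index \<open>j - card T\<close> can exceed
    \<open>n\<close> and miss the generators, but then the superset sum is empty.\<close>
  have "{S. T \<subseteq> S \<and> S \<subseteq> {1..n} \<and> card S = j} = {}"
    using False card_mono[of "{1..n}"] by fastforce
  then show ?thesis by (simp only: superset_sum_def sum.empty sym_ideal_0)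
next
  case True
  let ?i = "j - card T"
  let ?K = "{\<alpha>. \<alpha> \<subseteq> {1..n} \<and> card \<alpha> = ?i}"
  let ?D = "{\<alpha> \<in> ?K. \<alpha> \<inter> T = {}}" and ?N = "{\<alpha> \<in> ?K. \<alpha> \<inter> T \<noteq> {}}"
  have finT: "finite T" and fin: "\<And>\<alpha>. \<alpha> \<subseteq> {1..n} \<Longrightarrow> finite \<alpha>"
    using T by (auto intro: finite_subset[OF _ finite_atLeastAtMost])
  have "elem_sym n ?i * xprod T = (\<Sum>\<alpha>\<in>?K. xprod \<alpha> * xprod T)"
    by (simp add: elem_sym_eq sum_distrib_right)
  also have "?K = ?D \<union> ?N" by auto
  also have "(\<Sum>\<alpha>\<in>?D \<union> ?N. xprod \<alpha> * xprod T) = (\<Sum>\<alpha>\<in>?D. xprod \<alpha> * xprod T) + (\<Sum>\<alpha>\<in>?N. xprod \<alpha> * xprod T)"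
    by (rule sum.union_disjoint) auto
  also have "(\<Sum>\<alpha>\<in>?D. xprod \<alpha> * xprod T) = superset_sum n j T"
    unfolding superset_sum_def
  proof (rule sum.reindex_bij_witness[of _ "\<lambda>S. S - T" "\<lambda>\<alpha>. \<alpha> \<union> T"], goal_cases)
    case (2 \<alpha>)
    then show ?case using T finT fin by (auto simp: card_Un_disjoint)
  next
    case (4 S)
    then show ?case using T finT by (auto simp: card_Diff_subset)
  next
    case (5 \<alpha>)
    then show ?case using finT fin by (simp add: xprod_Un_disjoint)
  qed auto
  finally have eq: "elem_sym n ?i * xprod T = superset_sum n j T + (\<Sum>\<alpha>\<in>?N. xprod \<alpha> * xprod T)" .
  have "elem_sym n ?i * xprod T \<in> sym_ideal n"
    using T True by (intro sym_ideal_mult elem_sym_in_sym_ideal xprod_carrier) auto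
  moreover have "(\<Sum>\<alpha>\<in>?N. xprod \<alpha> * xprod T) \<in> sym_ideal n"
    using T by (intro sum_in_closed sym_ideal_0 sym_ideal_add xprod_mult_in_sym_ideal) auto
  ultimately have "elem_sym n ?i * xprod T + (\<Sum>\<alpha>\<in>?N. xprod \<alpha> * xprod T) \<in> sym_ideal n"
    by (rule sym_ideal_add)
  then show ?thesis
    unfolding eq by (simp only: add.assoc bpoly_add_self add_0_right)
qed

text \<open>The polynomials congruent to a sum of ballot monomials form an additive subgroup
  \<open>G\<close> containing the ideal. So it suffices to treat single monomials: the squarefree
  ones by \<open>ballots_span\<close>, the others because they lie in the ideal.\<close>

lemma sym_ideal_span:
  assumes p: "p \<in> homog_carrier n j"
  shows "\<exists>C\<subseteq>ballots n j. p + sum xprod C \<in> sym_ideal n"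
proof -
  define G where "G = {p. \<exists>C\<subseteq>ballots n j. p + sum xprod C \<in> sym_ideal n}"
  have ideal: "p \<in> G" if "p \<in> sym_ideal n" for p
    using that unfolding G_def by (intro CollectI exI[of _ "{}"]) simp
  have G0: "0 \<in> G" using ideal sym_ideal_0 .
  have Gadd: "p + q \<in> G" if pq: "p \<in> G" "q \<in> G" for p q
  proof -
    from pq obtain C D where CD: "C \<subseteq> ballots n j" "D \<subseteq> ballots n j"
      "p + sum xprod C \<in> sym_ideal n" "q + sum xprod D \<in> sym_ideal n"
      unfolding G_def by blast
    have fin: "finite C" "finite D" using CD finite_subset[OF _ finite_ballots] by auto
    \<comment> \<open>The witness for \<open>p + q\<close> is the symmetric difference of
      \<open>C\<close> and \<open>D\<close>: the monomials common to both occur twice and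
      cancel.\<close>
    have C: "sum xprod C = sum xprod (C - D) + sum xprod (C \<inter> D)"
      and D: "sum xprod D = sum xprod (D - C) + sum xprod (C \<inter> D)"
      using fin sum.Int_Diff[of C xprod D] sum.Int_Diff[of D xprod C]
      by (simp_all only: add.commute Int_commute)
    have "sum xprod ((C - D) \<union> (D - C)) = sum xprod (C - D) + sum xprod (D - C)"
      using fin by (intro sum.union_disjoint) auto
    also have "\<dots> = sum xprod C + sum xprod D"
    proof -
      have "sum xprod C + sum xprod D = sum xprod (C - D) + sum xprod (D - C)
          + (sum xprod (C \<inter> D) + sum xprod (C \<inter> D))"
        unfolding C D by (simp only: ac_simps)
      then show ?thesis by (simp only: bpoly_add_self add_0_right)
    qed
    finally have "(p + q) + sum xprod ((C - D) \<union> (D - C)) = (p + sum xprod C) + (q + sum xprod D)"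
      by (simp only: ac_simps)
    then have "(p + q) + sum xprod ((C - D) \<union> (D - C)) \<in> sym_ideal n"
      using sym_ideal_add[OF CD(3,4)] by (simp only:)
    moreover have "(C - D) \<union> (D - C) \<subseteq> ballots n j" using CD(1,2) by blast
    ultimately show ?thesis unfolding G_def by (intro CollectI exI conjI)
  qed
  have single: "Poly_Mapping.single k 1 \<in> G" if k: "k \<in> Poly_Mapping.keys p" for k
  proof (cases "\<forall>i. Poly_Mapping.lookup k i \<le> 1")
    case True
    then have eq: "smono (Poly_Mapping.keys k) = k" by (intro smono_keysI[symmetric]) simp
    have keys: "Poly_Mapping.keys k \<subseteq> {1..n}" and "mono_degree k = j"
      using p k by (auto simp: homog_carrier_def poly_carrier_def)
    then have card: "card (Poly_Mapping.keys k) = j"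
      using mono_degree_smono[of "Poly_Mapping.keys k"] eq by simp
    have ballot: "xprod B \<in> G" if "B \<in> ballots n j" for B
      unfolding G_def using that sym_ideal_0
      by (intro CollectI exI[of _ "{B}"]) simp
    have "superset_sum n j T \<in> G" if "T \<subseteq> {1..n}" "card T < j" for T
      using ideal superset_sum_in_sym_ideal that by blast
    from ballots_span[OF G0 Gadd ballot this keys card]
    have "xprod (Poly_Mapping.keys k) \<in> G" .
    then show ?thesis using eq by (simp add: xprod_eq_single)
  next
    case False
    then obtain i where "\<not> Poly_Mapping.lookup k i \<le> 1" by blast
    then have "Poly_Mapping.lookup k i \<ge> 2" by simp
    then show ?thesis
      using p k by (intro ideal nonsqfree_in_sym_ideal) (auto simp: homog_carrier_def poly_carrier_def)
  qed
  from sum_in_closed[OF G0 Gadd single]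
  have "(\<Sum>k\<in>Poly_Mapping.keys p. Poly_Mapping.single k 1) \<in> G" .
  then have "p \<in> G"
    by (simp only: bpoly_eq_sum_keys[symmetric])
  then show ?thesis
    by (simp only: G_def mem_Collect_eq)
qed

section \<open>Independence of the ballot monomials\<close>

text \<open>The second row of the tableau after the two entries of each column indexed by
  \<open>X\<close> have been interchanged.\<close>

definition swap_set :: "(nat \<Rightarrow> nat) \<Rightarrow> nat set \<Rightarrow> nat set \<Rightarrow> nat set" where
  "swap_set m B X = (B - X) \<union> m ` X"

text \<open>This is the pairing with the polytabloid of a two-row tableau, in which \<open>m\<close> maps each entry
  of the second row to the entry above it.\<close>

definition tab_sum :: "(nat \<Rightarrow> nat) \<Rightarrow> nat set \<Rightarrow> bpoly \<Rightarrow> bit" where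
  "tab_sum m B p = (\<Sum>X\<in>Pow B. Poly_Mapping.lookup p (smono (swap_set m B X)))"

lemma tab_sum_0: "tab_sum m B 0 = 0"
  by (simp add: tab_sum_def)

lemma tab_sum_add: "tab_sum m B (p + q) = tab_sum m B p + tab_sum m B q"
  by (simp only: tab_sum_def lookup_add sum.distrib)

lemma tab_sum_sum: "tab_sum m B (sum f A) = (\<Sum>a\<in>A. tab_sum m B (f a))"
  by (induction A rule: infinite_finite_induct) (simp_all add: tab_sum_0 tab_sum_add)

lemma card_swap_set:
  assumes "finite B" "inj_on m B" "m ` B \<inter> B = {}" "X \<subseteq> B"
  shows "card (swap_set m B X) = card B"
proof -
  have X: "finite X" "inj_on m X"
    using assms by (auto intro: finite_subset inj_on_subset)
  have "card (swap_set m B X) = card (B - X) + card (m ` X)"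
    unfolding swap_set_def using assms X by (intro card_Un_disjoint) auto
  also have "\<dots> = card B"
    using assms X by (simp add: card_image card_Diff_subset card_mono)
  finally show ?thesis .
qed

text \<open>The subsets with and without \<open>b\<close> pair off, and equal terms cancel in
  characteristic two.\<close>

lemma sum_Pow_eq_0:
  fixes f :: "'a set \<Rightarrow> bit"
  assumes "finite B" "b \<in> B" "\<And>X. X \<subseteq> B - {b} \<Longrightarrow> f (insert b X) = f X"
  shows "sum f (Pow B) = 0"
proof -
  have "Pow B = Pow (B - {b}) \<union> insert b ` Pow (B - {b})"
    using Pow_insert[of b "B - {b}"] assms(2) by (simp add: insert_absorb)
  then have "sum f (Pow B) = sum f (Pow (B - {b})) + sum f (insert b ` Pow (B - {b}))"
    using assms(1) by (simp only:) (rule sum.union_disjoint; auto)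
  also have "sum f (insert b ` Pow (B - {b})) = sum (\<lambda>X. f (insert b X)) (Pow (B - {b}))"
    by (subst sum.reindex) (auto simp: inj_on_def)
  also have "\<dots> = sum f (Pow (B - {b}))"
    using assms(3) by (intro sum.cong) auto
  finally show ?thesis
    by (cases "sum f (Pow (B - {b}))") simp_all
qed

text \<open>Solving for \<open>\<alpha>\<close> shows that at most one term of an elementary
  symmetric polynomial, multiplied by a fixed monomial, contributes to a given squarefree
  monomial.\<close>

lemma smono_add_eq_iff:
  assumes "finite \<alpha>" "finite S"
  shows "smono \<alpha> + k = smono S \<longleftrightarrow>
    k = smono (Poly_Mapping.keys k) \<and> Poly_Mapping.keys k \<subseteq> S \<and> \<alpha> = S - Poly_Mapping.keys k"
    (is "_ \<longleftrightarrow> ?R")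
proof
  assume eq: "smono \<alpha> + k = smono S"
  have *: "(if i \<in> \<alpha> then 1 else 0) + Poly_Mapping.lookup k i = (if i \<in> S then 1 else 0)" for i
    using arg_cong[OF eq, of "\<lambda>p. Poly_Mapping.lookup p i"] assms
    by (simp add: lookup_add lookup_smono)
  have "k = smono (Poly_Mapping.keys k)"
  proof (rule smono_keysI)
    show "Poly_Mapping.lookup k i \<le> 1" for i
      using *[of i] by (simp split: if_splits)
  qed
  moreover have keys: "i \<in> Poly_Mapping.keys k \<longleftrightarrow> i \<in> S \<and> i \<notin> \<alpha>" and "i \<in> \<alpha> \<Longrightarrow> i \<in> S" for i
    using *[of i] by (simp_all add: in_keys_iff split: if_splits)
  ultimately show ?R by blast
next
  assume R: ?R
  have "Poly_Mapping.lookup (smono \<alpha> + k) i = Poly_Mapping.lookup (smono S) i" for i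
  proof -
    have "Poly_Mapping.lookup k i = (if i \<in> Poly_Mapping.keys k then 1 else 0)"
      using R lookup_smono[OF finite_keys[of k], of i] by simp
    then show ?thesis
      using R assms by (auto simp: lookup_add lookup_smono)
  qed
  then show "smono \<alpha> + k = smono S" by (rule poly_mapping_eqI)
qed

lemma lookup_elem_sym_mult_single:
  assumes S: "S \<subseteq> {1..n}"
  shows "Poly_Mapping.lookup (elem_sym n i * Poly_Mapping.single k 1) (smono S) =
    (if k = smono (Poly_Mapping.keys k) \<and> Poly_Mapping.keys k \<subseteq> S \<and> card (S - Poly_Mapping.keys k) = i
     then 1 else 0)"
proof -
  let ?K = "{\<alpha>. \<alpha> \<subseteq> {1..n} \<and> card \<alpha> = i}"
  let ?P = "k = smono (Poly_Mapping.keys k) \<and> Poly_Mapping.keys k \<subseteq> S"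
  have fin: "finite \<alpha>" if "\<alpha> \<subseteq> {1..n}" for \<alpha>
    using that by (rule finite_subset) simp
  have "Poly_Mapping.lookup (elem_sym n i * Poly_Mapping.single k 1) (smono S) =
      (\<Sum>\<alpha>\<in>?K. Poly_Mapping.lookup (xprod \<alpha> * Poly_Mapping.single k 1) (smono S))"
    by (simp add: elem_sym_eq sum_distrib_right lookup_sum)
  also have "\<dots> = (\<Sum>\<alpha>\<in>?K. if \<alpha> = S - Poly_Mapping.keys k then (if ?P then 1 else 0) else 0)"
  proof (rule sum.cong[OF refl])
    fix \<alpha> assume "\<alpha> \<in> ?K"
    then have "finite \<alpha>" using fin by simp
    then have "Poly_Mapping.lookup (xprod \<alpha> * Poly_Mapping.single k 1) (smono S) =
        (if smono \<alpha> + k = smono S then 1 else 0)"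
      by (simp add: xprod_eq_single mult_single lookup_single when_def)
    then show "Poly_Mapping.lookup (xprod \<alpha> * Poly_Mapping.single k 1) (smono S) =
        (if \<alpha> = S - Poly_Mapping.keys k then (if ?P then 1 else 0) else 0)"
      unfolding smono_add_eq_iff[OF \<open>finite \<alpha>\<close> fin[OF S]] by simp
  qed
  also have "\<dots> = (if S - Poly_Mapping.keys k \<in> ?K then (if ?P then 1 else 0) else 0)"
    by simp
  also have "S - Poly_Mapping.keys k \<in> ?K \<longleftrightarrow> card (S - Poly_Mapping.keys k) = i"
    using S by auto
  finally show ?thesis by simp
qed

text \<open>The exponent of \<open>i\<close> in the product is at least 2, while squarefree
  monomials have exponents at most 1.\<close>

lemma lookup_var_square_mult_single:
  assumes "finite S"
  shows "Poly_Mapping.lookup (var i ^ 2 * Poly_Mapping.single k 1) (smono S) = 0"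
proof -
  let ?l = "Poly_Mapping.single i 1 + Poly_Mapping.single i 1 + k"
  have "Poly_Mapping.lookup ?l i \<ge> 2"
    by (simp add: lookup_add)
  then have "?l \<noteq> smono S"
    using assms by (metis lookup_smono numeral_le_one_iff not_numeral_le_zero semiring_norm(69))
  then show ?thesis
    by (simp add: var_def power2_eq_square mult_single lookup_single when_def)
qed

section \<open>Polytabloid functionals vanish on the ideal\<close>

context
  fixes n :: nat and B :: "nat set" and m :: "nat \<Rightarrow> nat"
  assumes B: "B \<subseteq> {1..n}" and inj: "inj_on m B" and mB: "m ` B \<subseteq> {1..n} - B"
begin

lemma finite_tab: "finite B"
  using B by (rule finite_subset) simp

lemma swap_set_subset: "X \<subseteq> B \<Longrightarrow> swap_set m B X \<subseteq> {1..n}"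
  using B mB by (auto simp: swap_set_def)

text \<open>Up to parity the value counts the sets \<open>X\<close> for which
  \<open>swap_set m B X\<close> contains the support \<open>?T\<close> of a squarefree
  \<open>k\<close> with exactly \<open>i\<close> elements left over. If some column misses
  \<open>?T\<close>, interchanging its entries affects neither condition and the count is
  even.\<close>

lemma tab_sum_elem_sym:
  assumes i: "i \<ge> 1"
  shows "tab_sum m B (elem_sym n i * Poly_Mapping.single k 1) = 0"
proof -
  let ?T = "Poly_Mapping.keys k"
  let ?f = "\<lambda>X. if k = smono ?T \<and> ?T \<subseteq> swap_set m B X \<and> card (swap_set m B X - ?T) = i
    then 1 else (0 :: bit)"
  have card: "card (swap_set m B X) = card B" if "X \<subseteq> B" for X
    using that finite_tab inj mB by (intro card_swap_set) auto
  have eq: "tab_sum m B (elem_sym n i * Poly_Mapping.single k 1) = sum ?f (Pow B)"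
    unfolding tab_sum_def
    by (intro sum.cong refl lookup_elem_sym_mult_single swap_set_subset) simp
  have diff: "card (swap_set m B X - ?T) = card B - card ?T" if "X \<subseteq> B" "?T \<subseteq> swap_set m B X" for X
    using that card by (simp add: card_Diff_subset)
  show ?thesis
  proof (cases "card ?T < card B")
    case False
    \<comment> \<open>A support with at least \<open>card B\<close> elements leaves nothing over,
      while \<open>i \<ge> 1\<close>.\<close>
    then have "?f X = 0" if "X \<in> Pow B" for X
      using that i diff[of X] by auto
    then show ?thesis unfolding eq by (rule sum.neutral[OF ballI])
  next
    case True
    have "\<exists>b\<in>B. b \<notin> ?T \<and> m b \<notin> ?T"
    proof (rule ccontr)
      assume *: "\<not> ?thesis"
      \<comment> \<open>If \<open>?T\<close> met every column, choosing one of its elements in each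
        of these disjoint columns would inject \<open>B\<close> into the smaller set
        \<open>?T\<close>.\<close>
      define g where "g b = (if b \<in> ?T then b else m b)" for b
      have "g ` B \<subseteq> ?T" using * by (auto simp: g_def)
      moreover have "inj_on g B"
        using inj mB by (auto simp: g_def inj_on_def)
      ultimately show False
        using True card_inj_on_le[of g B ?T] by simp
    qed
    then obtain b where b: "b \<in> B" "b \<notin> ?T" "m b \<notin> ?T" by blast
    show ?thesis unfolding eq
    proof (rule sum_Pow_eq_0[OF finite_tab b(1)])
      fix X assume X: "X \<subseteq> B - {b}"
      have "?T \<subseteq> swap_set m B (insert b X) \<longleftrightarrow> ?T \<subseteq> swap_set m B X"
        using b unfolding swap_set_def by blast
      moreover have "insert b X \<subseteq> B" "X \<subseteq> B" using X b by auto
      ultimately show "?f (insert b X) = ?f X"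
        using diff[of X] diff[of "insert b X"] by auto
    qed
  qed
qed

text \<open>Here \<open>J\<close> is the largest ideal inside the kernel of the functional. By
  additivity, a generator lies in \<open>J\<close> as soon as its products with monomials are
  killed.\<close>

lemma tab_sum_sym_ideal:
  assumes "p \<in> sym_ideal n"
  shows "tab_sum m B p = 0"
proof -
  define J where "J = {p \<in> poly_carrier n. \<forall>q\<in>poly_carrier n. tab_sum m B (p * q) = 0}"
  have single: "tab_sum m B (p * q) = 0" if "\<And>k. tab_sum m B (p * Poly_Mapping.single k 1) = 0" for p q
    by (subst bpoly_eq_sum_keys[of q]) (simp only: sum_distrib_left tab_sum_sum that sum.neutral_const)
  have "ideal J (poly_ring n)"
  proof (rule ideal_poly_ringI)
    show "p * q \<in> J" if "p \<in> J" "q \<in> poly_carrier n" for p q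
      using that unfolding J_def by (simp add: poly_carrier_mult mult.assoc)
  qed (auto simp: J_def poly_carrier_0 poly_carrier_add tab_sum_0 tab_sum_add distrib_right)
  moreover have "elem_sym n ` {1..n} \<subseteq> J"
  proof (rule image_subsetI)
    fix i assume "i \<in> {1..n}"
    then show "elem_sym n i \<in> J"
      unfolding J_def using elem_sym_carrier single[OF tab_sum_elem_sym] by simp
  qed
  moreover have "(\<lambda>i. var i ^ 2) ` {1..n} \<subseteq> J"
  proof (rule image_subsetI)
    fix i assume "i \<in> {1..n}"
    then have "var i ^ 2 \<in> poly_carrier n"
      unfolding power2_eq_square by (intro poly_carrier_mult var_carrier)
    moreover have "tab_sum m B (var i ^ 2 * Poly_Mapping.single k 1) = 0" for k
      unfolding tab_sum_def
    proof (intro sum.neutral ballI lookup_var_square_mult_single)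
      fix X assume "X \<in> Pow B"
      then show "finite (swap_set m B X)"
        using swap_set_subset[of X] finite_subset by blast
    qed
    ultimately show "var i ^ 2 \<in> J"
      unfolding J_def using single by blast
  qed
  ultimately have "sym_ideal n \<subseteq> J" by (rule sym_ideal_subset)
  then have "tab_sum m B (p * 1) = 0"
    using assms poly_carrier_1 unfolding J_def by blast
  then show ?thesis by simp
qed

end

text \<open>Each interchanged entry is replaced by the smaller one above it. This makes the
  functionals triangular on the ballot monomials.\<close>

lemma sum_swap_set_less:
  assumes B: "finite B" "inj_on m B" "m ` B \<inter> B = {}" and less: "\<And>b. b \<in> B \<Longrightarrow> m b < b"
    and X: "X \<subseteq> B" "X \<noteq> {}"
  shows "\<Sum>(swap_set m B X) < \<Sum>B"
proof -
  have fin: "finite X" and inj: "inj_on m X"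
    using B X by (auto intro: finite_subset inj_on_subset)
  have "\<Sum>(swap_set m B X) = \<Sum>(B - X) + \<Sum>(m ` X)"
    unfolding swap_set_def using B X fin by (intro sum.union_disjoint) auto
  also have "\<Sum>(m ` X) = sum m X"
    using inj by (simp add: sum.reindex)
  also have "sum m X < \<Sum>X"
    using fin X less by (intro sum_strict_mono) auto
  also have "\<Sum>(B - X) + \<Sum>X = \<Sum>B"
    using B(1) X(1) by (simp add: sum.subset_diff[of X B] add.commute)
  finally show ?thesis by simp
qed

text \<open>Take \<open>B\<close> in \<open>C\<close> with least element sum. A nontrivial
  interchange of columns lowers this sum and so leaves \<open>C\<close>; hence the functional of
  \<open>B\<close> is 1 on \<open>xprod B\<close> and 0 on the other monomials of \<open>C\<close>.
  It would be 1 on a sum lying in the ideal, where it vanishes.\<close>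

lemma ballots_indep:
  assumes C: "C \<subseteq> ballots n j" and sum: "sum xprod C \<in> sym_ideal n"
  shows "C = {}"
proof (rule ccontr)
  assume "C \<noteq> {}"
  have finC: "finite C" using C finite_ballots by (rule finite_subset)
  obtain B where B: "B \<in> C" and min: "\<And>B'. B' \<in> C \<Longrightarrow> \<Sum>B \<le> \<Sum>B'"
    using ex_min_if_finite[of "Sum ` C"] finC \<open>C \<noteq> {}\<close>
    by (metis (no_types, lifting) arg_min_least arg_min_if_finite(1))
  have Bn: "B \<subseteq> {1..n}" and finB: "finite B"
    using ballots_subset[of B n j] finite_ballot[of B n j] B C by auto
  have "B \<in> ballots n j" using B C by blast
  from ballot_matching[OF this] obtain m
    where m: "inj_on m B" "m ` B \<subseteq> {1..n} - B" "\<forall>b\<in>B. m b < b"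
    by (elim exE conjE)
  have swap: "swap_set m B X = B' \<longleftrightarrow> X = {} \<and> B' = B" if "X \<subseteq> B" "B' \<in> C" for X B'
  proof (cases "X = {}")
    case False
    then have "\<Sum>(swap_set m B X) < \<Sum>B"
      using that m finB by (intro sum_swap_set_less) auto
    then show ?thesis using min[OF that(2)] False by auto
  qed (auto simp: swap_set_def)
  have fin': "finite (swap_set m B X)" if "X \<subseteq> B" for X
    using that finB by (auto simp: swap_set_def intro: finite_subset)
  have "tab_sum m B (xprod B') = (if B' = B then 1 else 0)" if B': "B' \<in> C" for B'
  proof -
    have "finite B'" using B' C finite_ballot by blast
    have "tab_sum m B (xprod B') = (\<Sum>X\<in>Pow B. if X = {} then (if B' = B then 1 else 0) else 0)"
      unfolding tab_sum_def
    proof (rule sum.cong[OF refl])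
      fix X assume X: "X \<in> Pow B"
      then have "smono (swap_set m B X) = smono B' \<longleftrightarrow> X = {} \<and> B' = B"
        using smono_eq_iff[OF fin' \<open>finite B'\<close>] swap[OF _ B'] by simp
      then show "Poly_Mapping.lookup (xprod B') (smono (swap_set m B X)) =
          (if X = {} then (if B' = B then 1 else 0) else 0)"
        using \<open>finite B'\<close> by (simp add: lookup_xprod)
    qed
    then show ?thesis using finB by simp
  qed
  then have "tab_sum m B (sum xprod C) = 1"
    using finC B by (simp add: tab_sum_sum)
  moreover have "tab_sum m B (sum xprod C) = 0"
    using tab_sum_sym_ideal[OF Bn m(1,2) sum] .
  ultimately show False by simp
qed

section \<open>Dimension and degree of regularity\<close>

lemma quot_dim_eq_card_ballots: "quot_dim n j = card (ballots n j)"
  unfolding quot_dim_def quot_part_def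
proof (rule dim_quot_homog_part)
  have homog: "xprod B \<in> homog_carrier n j" if "B \<in> ballots n j" for B
    using ballots_subset[OF that] xprod_homog[of B n] by simp
  then show "B \<in> ballots n j \<Longrightarrow> xprod B \<in> homog_carrier n j" for B .
  show "\<exists>C\<subseteq>ballots n j. p + sum xprod C \<in> sym_ideal n \<inter> homog_carrier n j"
    if p: "p \<in> homog_carrier n j" for p
  proof -
    obtain C where C: "C \<subseteq> ballots n j" "p + sum xprod C \<in> sym_ideal n"
      using sym_ideal_span[OF p] by blast
    \<comment> \<open>Straightening gives membership in the ideal only; homogeneity of the sum
      places the difference in the part of degree \<open>j\<close>.\<close>
    have "sum xprod C \<in> homog_carrier n j"
    proof (rule sum_in_closed[OF homog_carrier_0 homog_carrier_add])
      show "xprod B \<in> homog_carrier n j" if "B \<in> C" for B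
        using that C(1) homog by blast
    qed
    from homog_carrier_add[OF p this] C show ?thesis by blast
  qed
  show "p + q \<in> sym_ideal n \<inter> homog_carrier n j"
    if "p \<in> sym_ideal n \<inter> homog_carrier n j" "q \<in> sym_ideal n \<inter> homog_carrier n j" for p q
    using that by (simp add: sym_ideal_add homog_carrier_add)
  show "C = {}" if "C \<subseteq> ballots n j" "sum xprod C \<in> sym_ideal n \<inter> homog_carrier n j" for C
    using ballots_indep[OF that(1)] that(2) by blast
qed (simp_all add: sym_ideal_0 homog_carrier_0 finite_ballots)

text \<open>In degree \<open>n div 2 + 1\<close> there are no ballot sets, so spanning puts every
  homogeneous polynomial into the ideal. In each smaller degree a ballot set exists, and by
  independence its monomial is outside the ideal.\<close>

lemma deg_reg_sym_ideal: "deg_reg n (sym_ideal n) = n div 2 + 1"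
  unfolding deg_reg_def
proof (rule Least_equality)
  have "ballots n (n div 2 + 1) = {}" by (rule ballots_eq_empty) simp
  then have "p \<in> sym_ideal n" if "p \<in> homog_carrier n (n div 2 + 1)" for p
    using sym_ideal_span[OF that] by simp
  then show "sym_ideal n \<inter> homog_carrier n (n div 2 + 1) = homog_carrier n (n div 2 + 1)"
    by blast
next
  fix d assume d: "sym_ideal n \<inter> homog_carrier n d = homog_carrier n d"
  show "n div 2 + 1 \<le> d"
  proof (rule ccontr)
    assume "\<not> ?thesis"
    then have "2 * d \<le> n" by simp
    then have "card (ballots n d) \<noteq> 0"
      using card_ballots[of d n] binom_diff_pos[of d n] by simp
    then obtain B where B: "B \<in> ballots n d" by fastforce
    then have "xprod B \<in> homog_carrier n d"
      using ballots_subset[OF B] xprod_homog[of B n] by simp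
    then have "sum xprod {B} \<in> sym_ideal n" using d by auto
    then show False using ballots_indep[of "{B}" n d] B by simp
  qed
qed

theorem proposition2p6:
  fixes n :: nat
  assumes "n \<ge> 1"
  shows "(\<forall>j. int (quot_dim n j) = (if j \<le> n div 2 then binom_diff n j else 0))
    \<and> (\<forall>j \<le> n div 2. binom_diff n j \<noteq> 0)
    \<and> deg_reg n (sym_ideal n) = n div 2 + 1"
proof (intro conjI allI impI)
  fix j
  show "int (quot_dim n j) = (if j \<le> n div 2 then binom_diff n j else 0)"
    by (simp add: quot_dim_eq_card_ballots card_ballots ballots_eq_empty)
  show "binom_diff n j \<noteq> 0" if "j \<le> n div 2"
  proof -
    have "2 * j \<le> n" using that by linarith
    from binom_diff_pos[OF this] show ?thesis by linarith
  qed
qed (rule deg_reg_sym_ideal)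

end
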